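(* Fix $x\in[0,1]$ and let the model assumptions (A) described in the context hold. Let $\nu>0$ be the constant from the concentration inequality recalled in the context, let $h^{\ast}=N^{-\frac{1}{\mathfrak a\beta+1}}$, $\hat f=\hat f_{h^\ast}$, $n=n(h^\ast,x)$, and let $\tau_n\to\infty$ with $\tau_n=o(n^{\nu})$. Define the truncated estimator $$\hat f^{\tau_n}(x)=\hat f(x)\,\mathbf 1(|\hat f(x)|\le\tau_n)+\tau_n\,\mathbf 1(|\hat f(x)|>\tau_n).$$ Then for any $q\ge1$ there exists $C>0$ (not depending on $N$) such that $$\mathbb E_f\big|\hat f^{\tau_n}(x)-f(x)\big|^q\le C\,N^{-\frac{q\beta}{\mathfrak a\beta+1}}.$$
   Context: **Hölder class.** For $\beta>0$ put $\langle\beta\rangle=\max\{m\in\mathbb N_0: m<\beta\}$. $f\in\mathcal H(L,\beta)$ means that $f$ is $\langle\beta\rangle$ times differentiable and $|f^{(\langle\beta\rangle)}(y)-f^{(\langle\beta\rangle)}(z)|\le L|y-z|^{\beta-\langle\beta\rangle}$ for all $y,z$ in the domain of the function ($[0,1]$ for the coefficient function $f$; $[0,\infty)$ for $F_\varepsilon$ below). **Model assumptions (A).** Fix $L,\beta>0$, $\rho\in(0,1)$, $\mathfrak a,\mathfrak c,\mathfrak c_g,\delta\in(0,\infty)$, $L_\varepsilon,\beta_\varepsilon>0$. The coefficient function $f:[0,1]\to[0,\rho]$ lies in $\mathcal H(L,\beta)$ and is extended to $\mathbb R$ by $f(u)=f(0)$ for $u<0$ and $f(u)=f(1)$ for $u>1$.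 The innovations $(\varepsilon_k)_{k\in\mathbb Z}$ are i.i.d. with distribution function $F_\varepsilon$ such that (i) as $y\downarrow0$, $F_\varepsilon(y)=\mathfrak c\,y^{\mathfrak a}+g(y)$ with $|g(y)|\le\mathfrak c_g\,y^{\mathfrak a+\delta}$ (so $\varepsilon_k\ge0$ a.s.), and $F_\varepsilon\in\mathcal H(L_\varepsilon,\beta_\varepsilon)$; (ii) $\mathbb E\varepsilon_1^p<\infty$ for $p=\max\{1,2\mathfrak a+\delta\}$. For $N\in\mathbb N$ the process satisfies $X_k=f(k/N)X_{k-1}+\varepsilon_k$ and is defined for all $k\in\mathbb Z$ by $X_k=\sum_{i\ge0}\big(\prod_{l=0}^{i-1}f(\tfrac{k-l}{N})\big)\varepsilon_{k-i}$. $\mathbb P_f,\mathbb E_f$ denote probability and expectation under coefficient function $f$. **Estimator.** Let $Y_k=X_k/X_{k-1}$ and $h>0$. Consider polynomials $p(y)=\sum_{0\le i\le\beta+1}b_i(y-x)^i$ (sum over integers $i$). The coefficient vector $(\hat b_i)$ is a maximiser of $\sum_{k:|k/N-x|\le h}p(k/N)$ over all $(b_i)$, subject to the constraints $p(k/N)\le Y_k$ for all $k\in\{1,\dots,N\}$ with $|k/N-x|\le h$. Then $\hat f_h(x):=\hat b_0$. The local sample size is $n(h,x)=|\{k\in\{1,\dots,N\}:k/N\in[x-h,x+h]\}|$. **The constant $\nu$.** $\nu>0$ is a constant such that, for some finite positive constants $c_1,c_2,c_3$, for all $N$, $h>0$ and $0\le v\le n^\nu$ with $n=n(h,x)$: $\sup_f\mathbb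 P_f(|\hat f_h(x)-f(x)|\ge c_1h^\beta+c_2n^{-1/\mathfrak a}v)\le c_3e^{-v^{\mathfrak a}}$, the supremum being over $f\in\mathcal H(L,\beta)$ with $0\le f\le\rho$; existence of such constants is a theorem under (A). *)

theory Defs
  imports "HOL-Probability.Probability" "HOL-Library.Landau_Symbols"
begin

definition holder_order :: "real \<Rightarrow> nat" where
  "holder_order \<beta> = Max {m. real m < \<beta>}"

text \<open>The Hoelder class of functions with domain \<open>S\<close>. The function \<open>D i\<close> is the \<open>i\<close>-th derivative
  of \<open>f\<close> on \<open>S\<close>, one-sided at the end points of \<open>S\<close>; it is unique on \<open>S\<close> if \<open>S\<close> is a
  nondegenerate interval.\<close>

definition holder_class :: "real \<Rightarrow> real \<Rightarrow> real set \<Rightarrow> (real \<Rightarrow> real) set" where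
  "holder_class L \<beta> S = {f. \<exists>D :: nat \<Rightarrow> real \<Rightarrow> real.
      (\<forall>y\<in>S. D 0 y = f y) \<and>
      (\<forall>i<holder_order \<beta>. \<forall>y\<in>S. (D i has_real_derivative D (Suc i) y) (at y within S)) \<and>
      (\<forall>y\<in>S. \<forall>z\<in>S. \<bar>D (holder_order \<beta>) y - D (holder_order \<beta>) z\<bar>
          \<le> L * \<bar>y - z\<bar> powr (\<beta> - real (holder_order \<beta>)))}"

text \<open>Only the values on \<open>[0,1]\<close> of a coefficient function are relevant; \<open>coeff_ext\<close> is the
  constant continuation.\<close>

definition coeff_class :: "real \<Rightarrow> real \<Rightarrow> real \<Rightarrow> (real \<Rightarrow> real) set" where
  "coeff_class L \<beta> \<rho> = {f \<in> holder_class L \<beta> {0..1}. \<forall>u\<in>{0..1}. 0 \<le> f u \<and> f u \<le> \<rho>}"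

definition coeff_ext :: "(real \<Rightarrow> real) \<Rightarrow> real \<Rightarrow> real" where
  "coeff_ext f u = (if u < 0 then f 0 else if u > 1 then f 1 else f u)"

locale innovations = prob_space M for M :: "'w measure" +
  fixes \<epsilon> :: "int \<Rightarrow> 'w \<Rightarrow> real"
    and \<aa> \<cc> c\<^sub>g \<delta> L\<^sub>\<epsilon> \<beta>\<^sub>\<epsilon> :: real
  assumes pos: "\<aa> > 0" "\<cc> > 0" "c\<^sub>g > 0" "\<delta> > 0" "L\<^sub>\<epsilon> > 0" "\<beta>\<^sub>\<epsilon> > 0"
    and indep: "indep_vars (\<lambda>_. borel) \<epsilon> UNIV"
    and ident: "\<And>k. distr M borel (\<epsilon> k) = distr M borel (\<epsilon> 1)"
    and cdf_at_0: "\<forall>\<^sub>F y in at_right 0.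
        \<bar>cdf (distr M borel (\<epsilon> 1)) y - \<cc> * y powr \<aa>\<bar> \<le> c\<^sub>g * y powr (\<aa> + \<delta>)"
    and cdf_holder: "cdf (distr M borel (\<epsilon> 1)) \<in> holder_class L\<^sub>\<epsilon> \<beta>\<^sub>\<epsilon> {0..}"
    and moment: "integrable M (\<lambda>\<omega>. \<bar>\<epsilon> 1 \<omega>\<bar> powr (max 1 (2 * \<aa> + \<delta>)))"

definition tvar :: "(int \<Rightarrow> 'w \<Rightarrow> real) \<Rightarrow> (real \<Rightarrow> real) \<Rightarrow> nat \<Rightarrow> int \<Rightarrow> 'w \<Rightarrow> real" where
  "tvar \<epsilon> f N k \<omega> =
     (\<Sum>i. (\<Prod>l<i. coeff_ext f (real_of_int (k - int l) / real N)) * \<epsilon> (k - int i) \<omega>)"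

definition ratio :: "(int \<Rightarrow> 'w \<Rightarrow> real) \<Rightarrow> (real \<Rightarrow> real) \<Rightarrow> nat \<Rightarrow> int \<Rightarrow> 'w \<Rightarrow> real" where
  "ratio \<epsilon> f N k \<omega> = tvar \<epsilon> f N k \<omega> / tvar \<epsilon> f N (k - 1) \<omega>"

definition window :: "nat \<Rightarrow> real \<Rightarrow> real \<Rightarrow> nat set" where
  "window N h x = {k \<in> {1..N}. \<bar>real k / real N - x\<bar> \<le> h}"

abbreviation local_size :: "nat \<Rightarrow> real \<Rightarrow> real \<Rightarrow> nat" where
  "local_size N h x \<equiv> card (window N h x)"

definition local_poly :: "real \<Rightarrow> real \<Rightarrow> (nat \<Rightarrow> real) \<Rightarrow> real \<Rightarrow> real" where
  "local_poly \<beta> x b y = (\<Sum>i | real i \<le> \<beta> + 1. b i * (y - x) ^ i)"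

definition maximiser ::
    "real \<Rightarrow> real \<Rightarrow> nat \<Rightarrow> real \<Rightarrow> (nat \<Rightarrow> real) \<Rightarrow> (nat \<Rightarrow> real) \<Rightarrow> bool" where
  "maximiser \<beta> x N h y b \<longleftrightarrow>
     is_arg_max (\<lambda>b. \<Sum>k\<in>window N h x. local_poly \<beta> x b (real k / real N))
       (\<lambda>b. \<forall>k\<in>window N h x. local_poly \<beta> x b (real k / real N) \<le> y k) b"

text \<open>The linear program may have several solutions. An estimator is any measurable function
  of the data vector \<open>(Y\<^sub>1, \<dots>, Y\<^sub>N)\<close> that returns the coefficient \<open>b 0\<close> of some solution.\<close>

definition boundary_estimator ::
    "real \<Rightarrow> real \<Rightarrow> (nat \<Rightarrow> real \<Rightarrow> (nat \<Rightarrow> real) \<Rightarrow> real) \<Rightarrow> bool" where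
  "boundary_estimator \<beta> x T \<longleftrightarrow> (\<forall>N\<ge>1. \<forall>h>0.
     T N h \<in> borel_measurable (Pi\<^sub>M {1..N} (\<lambda>_. borel)) \<and>
     (\<forall>y \<in> space (Pi\<^sub>M {1..N} (\<lambda>_. borel :: real measure)). \<exists>b. maximiser \<beta> x N h y b \<and> T N h y = b 0))"

definition estimate :: "(nat \<Rightarrow> real \<Rightarrow> (nat \<Rightarrow> real) \<Rightarrow> real) \<Rightarrow> (int \<Rightarrow> 'w \<Rightarrow> real)
    \<Rightarrow> (real \<Rightarrow> real) \<Rightarrow> nat \<Rightarrow> real \<Rightarrow> 'w \<Rightarrow> real" where
  "estimate T \<epsilon> f N h \<omega> = T N h (\<lambda>k\<in>{1..N}. ratio \<epsilon> f N (int k) \<omega>)"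

definition concentration_exponent :: "'w measure \<Rightarrow> (int \<Rightarrow> 'w \<Rightarrow> real) \<Rightarrow> real \<Rightarrow> real \<Rightarrow> real
    \<Rightarrow> real \<Rightarrow> real \<Rightarrow> (nat \<Rightarrow> real \<Rightarrow> (nat \<Rightarrow> real) \<Rightarrow> real) \<Rightarrow> real \<Rightarrow> bool" where
  "concentration_exponent M \<epsilon> L \<beta> \<rho> \<aa> x T \<nu> \<longleftrightarrow> \<nu> > 0 \<and>
     (\<exists>c\<^sub>1>0. \<exists>c\<^sub>2>0. \<exists>c\<^sub>3>0. \<forall>N\<ge>1. \<forall>h>0. \<forall>v.
        0 \<le> v \<and> v \<le> real (local_size N h x) powr \<nu> \<longrightarrow>
        (\<forall>f \<in> coeff_class L \<beta> \<rho>.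
           measure M {\<omega> \<in> space M. \<bar>estimate T \<epsilon> f N h \<omega> - f x\<bar>
               \<ge> c\<^sub>1 * h powr \<beta> + c\<^sub>2 * real (local_size N h x) powr (- 1 / \<aa>) * v}
             \<le> c\<^sub>3 * exp (- (v powr \<aa>))))"

definition optimal_bandwidth :: "real \<Rightarrow> real \<Rightarrow> nat \<Rightarrow> real" where
  "optimal_bandwidth \<aa> \<beta> N = real N powr (- 1 / (\<aa> * \<beta> + 1))"

definition truncate_at :: "real \<Rightarrow> real \<Rightarrow> real" where
  "truncate_at t u = u * of_bool (\<bar>u\<bar> \<le> t) + t * of_bool (\<bar>u\<bar> > t)"

definition truncated_estimate :: "(nat \<Rightarrow> real) \<Rightarrow> real \<Rightarrow> real \<Rightarrow> real
    \<Rightarrow> (nat \<Rightarrow> real \<Rightarrow> (nat \<Rightarrow> real) \<Rightarrow> real) \<Rightarrow> (int \<Rightarrow> 'w \<Rightarrow> real) \<Rightarrow> (real \<Rightarrow> real) \<Rightarrow> nat \<Rightarrow> 'w \<Rightarrow> real" where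
  "truncated_estimate \<tau> \<aa> \<beta> x T \<epsilon> f N \<omega> =
     truncate_at (\<tau> (local_size N (optimal_bandwidth \<aa> \<beta> N) x))
       (estimate T \<epsilon> f N (optimal_bandwidth \<aa> \<beta> N) \<omega>)"

end

theory Submission imports Defs "HOL-Real_Asymp.Real_Asymp" begin

text \<open>The tail bound is integrated over the shells \<open>s (1 + j) \<le> |error| < s (2 + j)\<close>, where \<open>s\<close> is
  of the order of the rate, as long as \<open>j \<le> n powr \<nu>\<close>. Beyond that the truncated error is at most
  \<open>\<tau>\<^sub>n + 1\<close>, while the probability is at most a constant times \<open>exp (- (n powr (\<nu> \<aa>)))\<close>, which beats
  every power of \<open>n\<close>. For the optimal bandwidth both \<open>h powr \<beta>\<close> and \<open>n powr (- 1 / \<aa>)\<close> are of the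
  order of the rate. The finitely many \<open>N\<close> for which the asymptotics do not yet hold are absorbed in
  the constant, because the truncated error is bounded.\<close>

section \<open>Convergence and domination of exponential terms\<close>

lemma summable_powr_times_exp_neg_powr:
  fixes a q :: real
  assumes "a > 0"
  shows "summable (\<lambda>j::nat. (2 + real j) powr q * exp (- (real j powr a)))"
proof (rule summable_comparison_test_bigo)
  show "summable (\<lambda>j. norm (real j powr (-2)))"
    by (simp add: summable_real_powr_iff)
  show "(\<lambda>j. (2 + real j) powr q * exp (- (real j powr a))) \<in> O(\<lambda>j. real j powr (-2))"
    using assms by real_asymp
qed

text \<open>Used for the event beyond the last shell: the truncated error there is at most
  \<open>real n powr \<nu> + 1\<close>, and the exponential is the tail bound at the largest
  admissible level. The right-hand side is the q-th power of the stochastic rate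
  \<open>real n powr (- 1 / a)\<close>.\<close>

lemma eventually_powr_times_exp_le_powr:
  fixes a \<nu> q :: real
  assumes "a > 0" "\<nu> > 0"
  shows "\<forall>\<^sub>F n in sequentially.
    (real n powr \<nu> + 1) powr q * exp (- ((real n powr \<nu>) powr a)) \<le> real n powr (- q / a)"
  unfolding powr_powr using assms by real_asymp

lemma uniform_bound_from_eventual:
  fixes A b :: "nat \<Rightarrow> real"
  assumes "\<forall>\<^sub>F N in sequentially. A N \<le> C * b N" and "\<And>N. N \<ge> 1 \<Longrightarrow> b N > 0"
  shows "\<exists>C>0. \<forall>N\<ge>1. A N \<le> C * b N"
proof -
  from assms(1) obtain N0 where N0: "\<And>N. N \<ge> N0 \<Longrightarrow> A N \<le> C * b N"
    by (auto simp: eventually_sequentially)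
  \<comment> \<open>The sum dominates each ratio at the exceptional N, \<open>\<bar>C\<bar>\<close>
    covers the others, and the 1 makes K positive in any case. The index 0, where \<open>b\<close>
    may vanish, only adds a nonnegative term.\<close>
  define K where "K = \<bar>C\<bar> + 1 + (\<Sum>N<N0. \<bar>A N / b N\<bar>)"
  have S: "(\<Sum>N<N0. \<bar>A N / b N\<bar>) \<ge> 0" by (intro sum_nonneg) auto
  have "A N \<le> K * b N" if "N \<ge> 1" for N
  proof (cases "N \<ge> N0")
    case True
    have "C * b N \<le> K * b N"
      using assms(2)[OF that] S by (intro mult_right_mono) (auto simp: K_def)
    with N0[OF True] show ?thesis by linarith
  next
    case False
    then have "\<bar>A N / b N\<bar> \<le> (\<Sum>N<N0. \<bar>A N / b N\<bar>)"
      by (intro member_le_sum) auto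
    then have "A N / b N \<le> K" unfolding K_def by linarith
    with assms(2)[OF that] show ?thesis by (simp add: field_simps)
  qed
  moreover have "K > 0" using S by (simp add: K_def)
  ultimately show ?thesis by blast
qed

section \<open>From a tail bound to a moment bound\<close>

text \<open>Two variables occur because the tail is known for the untruncated error Z, while the
  bound B holds only for the truncated error W. Up to level V, \<open>W \<le> A * Z\<close> carries
  the shells of Z over to W; beyond it, B takes over. The full series in the result makes the
  constant independent of V, hence of the sample size.\<close>

lemma (in prob_space) powr_expectation_le_of_tail:
  fixes Z W :: "'a \<Rightarrow> real"
  assumes [measurable]: "Z \<in> borel_measurable M" "W \<in> borel_measurable M"
    and "s > 0" "A > 0" "c > 0" "a > 0" "q \<ge> 0" "V \<ge> 0"
    and W: "\<And>\<omega>. 0 \<le> W \<omega>" "\<And>\<omega>. W \<omega> \<le> A * Z \<omega>" "\<And>\<omega>. W \<omega> \<le> B"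
    and tail: "\<And>v. 0 \<le> v \<Longrightarrow> v \<le> V \<Longrightarrow>
      prob {\<omega>\<in>space M. s * (1 + v) \<le> Z \<omega>} \<le> c * exp (- (v powr a))"
  shows "expectation (\<lambda>\<omega>. W \<omega> powr q)
    \<le> (A * s) powr q * (1 + c * (\<Sum>j. (2 + real j) powr q * exp (- (real j powr a))))
      + B powr q * (c * exp (- (V powr a)))"
proof -
  define J where "J = nat \<lfloor>V\<rfloor>"
  define E where "E v = {\<omega>\<in>space M. s * (1 + v) \<le> Z \<omega>}" for v
  have [measurable]: "E v \<in> sets M" for v unfolding E_def by measurable
  have J: "real J \<le> V" "V < real J + 1"
    using \<open>V \<ge> 0\<close> unfolding J_def by linarith+
  \<comment> \<open>The indicators belong to whole upper tails rather than shells, so that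
    \<open>tail\<close> applies directly; pointwise only the summand of the shell containing Z is
    needed. All levels used, \<open>j \<le> J\<close> and V itself, lie in the range of
    \<open>tail\<close>.\<close>
  define G where "G \<omega> = (A * s) powr q * (1 + (\<Sum>j\<le>J. (2 + real j) powr q * indicator (E (real j)) \<omega>))
      + B powr q * indicator (E V) \<omega>" for \<omega>
  have le: "W \<omega> powr q \<le> G \<omega>" if \<omega>: "\<omega> \<in> space M" for \<omega>
  proof -
    have sum_nn: "0 \<le> (\<Sum>j\<le>J. (2 + real j) powr q * indicator (E (real j)) \<omega> :: real)"
      by (intro sum_nonneg) auto
    have last_nn: "0 \<le> B powr q * (indicator (E V) \<omega> :: real)" by simp
    \<comment> \<open>The shells up to J end at \<open>s * (2 + real J)\<close>. As
      \<open>V < real J + 1\<close>, everything from there on lies in \<open>E V\<close>, so no gap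
      is left.\<close>
    consider "Z \<omega> < s" | "s \<le> Z \<omega>" "Z \<omega> < s * (2 + real J)" | "s * (2 + real J) \<le> Z \<omega>"
      by linarith
    then show ?thesis
    proof cases
      case 1
      then have "W \<omega> \<le> A * s" using W(2)[of \<omega>] \<open>A > 0\<close>
        by (smt (verit) mult_left_mono)
      then have "W \<omega> powr q \<le> (A * s) powr q" using W(1) \<open>q \<ge> 0\<close> by (intro powr_mono2) auto
      also have "\<dots> \<le> (A * s) powr q * (1 + (\<Sum>j\<le>J. (2 + real j) powr q * indicator (E (real j)) \<omega>))"
        using sum_nn by (simp add: algebra_simps)
      finally show ?thesis using last_nn unfolding G_def by linarith
    next
      case 2
      define j where "j = nat \<lfloor>Z \<omega> / s - 1\<rfloor>"
      have "Z \<omega> / s - 1 \<ge> 0" using 2 \<open>s > 0\<close> by simp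
      then have j: "real j \<le> Z \<omega> / s - 1" "Z \<omega> / s - 1 < real j + 1"
        unfolding j_def by linarith+
      have "Z \<omega> / s < 2 + real J" using 2 \<open>s > 0\<close> by (simp add: field_simps)
      with j(1) have "j \<le> J" by linarith
      have "\<omega> \<in> E (real j)" using j(1) \<omega> \<open>s > 0\<close> by (simp add: E_def field_simps)
      have "Z \<omega> \<le> s * (2 + real j)" using j(2) \<open>s > 0\<close> by (simp add: field_simps)
      then have "A * Z \<omega> \<le> A * (s * (2 + real j))" using \<open>A > 0\<close> by (intro mult_left_mono) auto
      with W(2)[of \<omega>] have "W \<omega> \<le> (A * s) * (2 + real j)" by (simp add: mult.assoc)
      then have "W \<omega> powr q \<le> ((A * s) * (2 + real j)) powr q"
        using W(1) \<open>q \<ge> 0\<close> by (intro powr_mono2) auto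
      also have "\<dots> = (A * s) powr q * (2 + real j) powr q"
        using \<open>A > 0\<close> \<open>s > 0\<close> by (simp add: powr_mult)
      also have "(2 + real j) powr q = (2 + real j) powr q * indicator (E (real j)) \<omega>"
        using \<open>\<omega> \<in> E (real j)\<close> by simp
      also have "\<dots> \<le> (\<Sum>j\<le>J. (2 + real j) powr q * indicator (E (real j)) \<omega>)"
        using \<open>j \<le> J\<close> by (intro member_le_sum) auto
      also have "\<dots> \<le> 1 + \<dots>" by simp
      finally have "W \<omega> powr q \<le> (A * s) powr q *
          (1 + (\<Sum>j\<le>J. (2 + real j) powr q * indicator (E (real j)) \<omega>))"
        by (simp add: mult_left_mono)
      then show ?thesis using last_nn unfolding G_def by linarith
    next
      case 3
      have "s * (1 + V) \<le> s * (2 + real J)" using J \<open>s > 0\<close> by (intro mult_left_mono) auto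
      with 3 \<omega> have "\<omega> \<in> E V" by (simp add: E_def)
      moreover have "W \<omega> powr q \<le> B powr q" using W \<open>q \<ge> 0\<close> by (intro powr_mono2) auto
      moreover have "0 \<le> (A * s) powr q *
          (1 + (\<Sum>j\<le>J. (2 + real j) powr q * indicator (E (real j)) \<omega>))"
        using sum_nn by (intro mult_nonneg_nonneg) auto
      ultimately show ?thesis by (simp add: G_def)
    qed
  qed
  have one: "has_bochner_integral M (\<lambda>_. 1) (1 :: real)"
    by (simp add: has_bochner_integral_iff prob_space)
  have G: "has_bochner_integral M G
      ((A * s) powr q * (1 + (\<Sum>j\<le>J. (2 + real j) powr q * prob (E (real j)))) + B powr q * prob (E V))"
    unfolding G_def
    by (intro has_bochner_integral_add has_bochner_integral_mult_right has_bochner_integral_sum one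
          has_bochner_integral_real_indicator)
       (auto simp: less_top[symmetric])
  then have "integrable M G" by (rule integrable.intros)
  then have "expectation (\<lambda>\<omega>. W \<omega> powr q) \<le> expectation G"
    \<comment> \<open>This form of monotonicity takes integrability and nonnegativity of the larger
      function; the latter follows from \<open>0 \<le> W powr q \<le> G\<close>.\<close>
    by (rule integral_mono'[OF _ le order_trans[OF powr_ge_zero le]])
  also have "\<dots> = (A * s) powr q * (1 + (\<Sum>j\<le>J. (2 + real j) powr q * prob (E (real j))))
      + B powr q * prob (E V)"
    using G by (rule has_bochner_integral_integral_eq)
  also have "\<dots> \<le> (A * s) powr q * (1 + (\<Sum>j\<le>J. (2 + real j) powr q * (c * exp (- (real j powr a)))))
      + B powr q * (c * exp (- (V powr a)))"
    using J \<open>V \<ge> 0\<close> unfolding E_def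
    by (intro add_mono mult_left_mono sum_mono tail order_refl) auto
  also have "(\<Sum>j\<le>J. (2 + real j) powr q * (c * exp (- (real j powr a))))
      = c * (\<Sum>j\<le>J. (2 + real j) powr q * exp (- (real j powr a)))"
    by (simp add: sum_distrib_left mult_ac)
  also have "(A * s) powr q * (1 + c * (\<Sum>j\<le>J. (2 + real j) powr q * exp (- (real j powr a))))
      \<le> (A * s) powr q * (1 + c * (\<Sum>j. (2 + real j) powr q * exp (- (real j powr a))))"
    using \<open>c > 0\<close> summable_powr_times_exp_neg_powr[OF \<open>a > 0\<close>, of q]
    by (intro mult_left_mono add_left_mono sum_le_suminf) auto
  finally show ?thesis by simp
qed

section \<open>Number of design points in the window\<close>

text \<open>Even for x at the boundary, the window contains an interval of length h/2 inside [0,1],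
  and a half-open interval of that length contains more than N h / 2 - 1 grid points.\<close>

lemma card_window_ge:
  assumes "N \<ge> 1" "0 < h" "h \<le> 1" "x \<in> {0..1}"
  shows "real (local_size N h x) \<ge> real N * h / 2 - 1"
proof -
  \<comment> \<open>The interval points away from the nearer end of [0,1]: to the right of x in the
    left half, to the left of x in the right half. It stays in [0,1] because
    \<open>h \<le> 1\<close>.\<close>
  define a where "a = (if x \<le> 1/2 then x else x - h / 2)"
  have a: "a \<ge> 0" "a + h / 2 \<le> 1" "x - h \<le> a" "a + h / 2 \<le> x + h"
    using assms by (auto simp: a_def)
  define m where "m = nat \<lfloor>real N * a\<rfloor>"
  define m' where "m' = nat \<lfloor>real N * (a + h / 2)\<rfloor>"
  have "real N * a \<ge> 0" "real N * (a + h / 2) \<ge> 0" using a assms by auto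
  then have m: "real m \<le> real N * a" "real N * a < real m + 1"
    and m': "real m' \<le> real N * (a + h / 2)" "real N * (a + h / 2) < real m' + 1"
    unfolding m_def m'_def by linarith+
  \<comment> \<open>Leaving out m excludes k = 0, which is not a design point, even when a =
    0.\<close>
  have "{m<..m'} \<subseteq> window N h x"
  proof
    fix k assume "k \<in> {m<..m'}"
    then have k: "real N * a < real k" "real k \<le> real N * (a + h / 2)" "k \<ge> 1"
      using m m' by auto
    have k': "a < real k / real N" "real k / real N \<le> a + h / 2"
      using k assms(1) by (auto simp: field_simps)
    then have "real k / real N \<le> 1" using a by linarith
    then have "k \<le> N" using assms(1) by (simp add: field_simps)
    then show "k \<in> window N h x" using k k' a by (auto simp: window_def)
  qed
  then have "m' - m \<le> local_size N h x"
    using card_mono[of "window N h x" "{m<..m'}"] by (simp add: window_def)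
  then have "real m' - real m \<le> real (local_size N h x)" by linarith
  then show ?thesis using m m' by (simp add: algebra_simps)
qed

section \<open>Truncation and measurability\<close>

lemma abs_truncate_at_le: "\<bar>truncate_at t u\<bar> \<le> \<bar>t\<bar>"
  by (auto simp: truncate_at_def)

text \<open>For u above t, truncation moves u towards y. A u below -t is sent to +t, on the other
  side of y, but there \<open>\<bar>u - y\<bar>\<close> exceeds t while the new error is at most t.
  The factor 3 is generous.\<close>

lemma truncate_at_error_le:
  assumes "t \<ge> 2" "0 \<le> y" "y \<le> 1"
  shows "\<bar>truncate_at t u - y\<bar> \<le> 3 * \<bar>u - y\<bar>"
  using assms by (auto simp: truncate_at_def abs_if)

lemma measurable_truncate_at [measurable]: "truncate_at t \<in> borel_measurable borel"
  unfolding truncate_at_def[abs_def] by measurable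

lemma measurable_estimate:
  assumes "boundary_estimator \<beta> x T" "N \<ge> 1" "h > 0"
    and [measurable]: "\<And>k. \<epsilon> k \<in> borel_measurable M"
  shows "estimate T \<epsilon> f N h \<in> borel_measurable M"
proof -
  have [measurable]: "T N h \<in> borel_measurable (Pi\<^sub>M {1..N} (\<lambda>_. borel))"
    using assms by (auto simp: boundary_estimator_def)
  \<comment> \<open>\<open>suminf\<close> of measurable summands is measurable whether or not the
    series converges.\<close>
  have [measurable]: "ratio \<epsilon> f N k \<in> borel_measurable M" for k
    unfolding ratio_def[abs_def] tvar_def by measurable
  show ?thesis unfolding estimate_def[abs_def] by measurable
qed

section \<open>The optimal bandwidth and its local sample size\<close>

lemma optimal_bandwidth_bounds:
  assumes "\<aa> > 0" "\<beta> > 0" "N \<ge> 1"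
  shows "0 < optimal_bandwidth \<aa> \<beta> N" "optimal_bandwidth \<aa> \<beta> N \<le> 1"
proof -
  show "0 < optimal_bandwidth \<aa> \<beta> N" using assms by (simp add: optimal_bandwidth_def)
  have "\<aa> * \<beta> > 0" using assms by simp
  then show "optimal_bandwidth \<aa> \<beta> N \<le> 1"
    using assms powr_mono[of "- 1 / (\<aa> * \<beta> + 1)" 0 "real N"] by (simp add: optimal_bandwidth_def)
qed

lemma optimal_bandwidth_powr:
  "optimal_bandwidth \<aa> \<beta> N powr \<beta> = real N powr (- \<beta> / (\<aa> * \<beta> + 1))"
  by (simp add: optimal_bandwidth_def powr_powr)

text \<open>Raised to the power \<open>- 1 / \<aa>\<close>, this is exactly
  \<open>h powr \<beta>\<close>: the bandwidth balances bias and stochastic error.\<close>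

lemma times_optimal_bandwidth:
  assumes "\<aa> > 0" "\<beta> > 0" "N \<ge> 1"
  shows "real N * optimal_bandwidth \<aa> \<beta> N = real N powr (\<aa> * \<beta> / (\<aa> * \<beta> + 1))"
proof -
  have "\<aa> * \<beta> > 0" using assms by simp
  then have "\<aa> * \<beta> / (\<aa> * \<beta> + 1) = 1 + - 1 / (\<aa> * \<beta> + 1)" by (simp add: field_simps)
  then show ?thesis using assms by (simp only: powr_add optimal_bandwidth_def) simp
qed

lemma filterlim_local_size:
  assumes "\<aa> > 0" "\<beta> > 0" "x \<in> {0..1}"
  shows "filterlim (\<lambda>N. local_size N (optimal_bandwidth \<aa> \<beta> N) x) at_top sequentially"
    and "\<forall>\<^sub>F N in sequentially. real (local_size N (optimal_bandwidth \<aa> \<beta> N) x)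
        \<ge> real N powr (\<aa> * \<beta> / (\<aa> * \<beta> + 1)) / 4"
proof -
  define g where "g = \<aa> * \<beta> / (\<aa> * \<beta> + 1)"
  have "\<aa> * \<beta> > 0" using assms by simp
  then have "g > 0" by (simp add: g_def)
  then have lim: "filterlim (\<lambda>N. real N powr g / 4) at_top sequentially" by real_asymp
  \<comment> \<open>Once N h is at least 4, the lower bound N h / 2 - 1 is at least N h / 4.\<close>
  have "\<forall>\<^sub>F N in sequentially. real N powr g / 4 \<ge> 1"
    using lim unfolding filterlim_at_top by blast
  then show *: "\<forall>\<^sub>F N in sequentially. real (local_size N (optimal_bandwidth \<aa> \<beta> N) x)
      \<ge> real N powr (\<aa> * \<beta> / (\<aa> * \<beta> + 1)) / 4"
    using eventually_ge_at_top[of 1]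
  proof eventually_elim
    case (elim N)
    show ?case
      using card_window_ge[OF elim(2) optimal_bandwidth_bounds[OF assms(1,2) elim(2)] assms(3)]
        times_optimal_bandwidth[OF assms(1,2) elim(2)] elim(1)
      by (simp add: g_def)
  qed
  have "filterlim (\<lambda>N. real (local_size N (optimal_bandwidth \<aa> \<beta> N) x)) at_top sequentially"
    using lim * unfolding g_def by (rule filterlim_at_top_mono)
  then show "filterlim (\<lambda>N. local_size N (optimal_bandwidth \<aa> \<beta> N) x) at_top sequentially"
    by (simp add: filterlim_sequentially_iff_filterlim_real)
qed

section \<open>The risk bound\<close>

theorem corollary2p3:
  fixes M :: "'w measure" and \<epsilon> :: "int \<Rightarrow> 'w \<Rightarrow> real"
    and L \<beta> \<rho> \<aa> \<cc> c\<^sub>g \<delta> L\<^sub>\<epsilon> \<beta>\<^sub>\<epsilon> x \<nu> q :: real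
    and f :: "real \<Rightarrow> real"
    and T :: "nat \<Rightarrow> real \<Rightarrow> (nat \<Rightarrow> real) \<Rightarrow> real"
    and \<tau> :: "nat \<Rightarrow> real"
  assumes "L > 0" and "\<beta> > 0" and "0 < \<rho>" and "\<rho> < 1"
    and "innovations M \<epsilon> \<aa> \<cc> c\<^sub>g \<delta> L\<^sub>\<epsilon> \<beta>\<^sub>\<epsilon>"
    and "f \<in> coeff_class L \<beta> \<rho>"
    and "x \<in> {0..1}"
    and "boundary_estimator \<beta> x T"
    and "concentration_exponent M \<epsilon> L \<beta> \<rho> \<aa> x T \<nu>"
    and "filterlim \<tau> at_top sequentially"
    and "\<tau> \<in> o(\<lambda>n. real n powr \<nu>)"
    and "q \<ge> 1"
  shows "\<exists>C>0. \<forall>N\<ge>1.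
      integrable M (\<lambda>\<omega>. \<bar>truncated_estimate \<tau> \<aa> \<beta> x T \<epsilon> f N \<omega> - f x\<bar> powr q) \<and>
      (\<integral>\<omega>. \<bar>truncated_estimate \<tau> \<aa> \<beta> x T \<epsilon> f N \<omega> - f x\<bar> powr q \<partial>M)
        \<le> C * real N powr (- (q * \<beta>) / (\<aa> * \<beta> + 1))"
proof -
  interpret innovations M \<epsilon> \<aa> \<cc> c\<^sub>g \<delta> L\<^sub>\<epsilon> \<beta>\<^sub>\<epsilon> by fact
  have "\<nu> > 0" using assms(9) by (simp add: concentration_exponent_def)
  from assms(9) obtain c1 c2 c3 where c: "c1 > 0" "c2 > 0" "c3 > 0"
    and conc_all: "\<forall>N\<ge>1. \<forall>h>0. \<forall>v.
        0 \<le> v \<and> v \<le> real (local_size N h x) powr \<nu> \<longrightarrow>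
        (\<forall>f \<in> coeff_class L \<beta> \<rho>.
           prob {\<omega> \<in> space M. \<bar>estimate T \<epsilon> f N h \<omega> - f x\<bar>
               \<ge> c1 * h powr \<beta> + c2 * real (local_size N h x) powr (- 1 / \<aa>) * v}
             \<le> c3 * exp (- (v powr \<aa>)))"
    unfolding concentration_exponent_def by (elim conjE exE)
  have conc: "prob {\<omega> \<in> space M. \<bar>estimate T \<epsilon> f N h \<omega> - f x\<bar>
               \<ge> c1 * h powr \<beta> + c2 * real (local_size N h x) powr (- 1 / \<aa>) * v}
             \<le> c3 * exp (- (v powr \<aa>))"
    if "N \<ge> 1" "h > 0" "0 \<le> v" "v \<le> real (local_size N h x) powr \<nu>" for N h v
    using conc_all[rule_format, OF that(1,2) conjI[OF that(3,4)] assms(6)] .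
  have "0 \<le> f x \<and> f x \<le> \<rho>" using assms(6,7) by (auto simp: coeff_class_def)
  then have fx: "0 \<le> f x" "f x \<le> 1" using assms(4) by auto
  have [measurable]: "\<epsilon> k \<in> borel_measurable M" for k
    using indep by (auto simp: indep_vars_def)
  define h where "h N = optimal_bandwidth \<aa> \<beta> N" for N
  define n where "n N = local_size N (h N) x" for N
  define r where "r N = real N powr (- \<beta> / (\<aa> * \<beta> + 1))" for N
  define Z where "Z N \<omega> = \<bar>estimate T \<epsilon> f N (h N) \<omega> - f x\<bar>" for N \<omega>
  define W where "W N \<omega> = \<bar>truncated_estimate \<tau> \<aa> \<beta> x T \<epsilon> f N \<omega> - f x\<bar>" for N \<omega>
  have W_eq: "W N \<omega> = \<bar>truncate_at (\<tau> (n N)) (estimate T \<epsilon> f N (h N) \<omega>) - f x\<bar>" for N \<omega>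
    by (simp add: W_def truncated_estimate_def n_def h_def)
  have h: "h N > 0" if "N \<ge> 1" for N
    using optimal_bandwidth_bounds(1)[OF pos(1) assms(2) that] by (simp add: h_def)
  have r_pos: "r N > 0" if "N \<ge> 1" for N using that by (simp add: r_def)
  have r_powr: "r N powr q = real N powr (- (q * \<beta>) / (\<aa> * \<beta> + 1))" for N
    by (simp add: r_def powr_powr mult_ac)
  have est_meas: "estimate T \<epsilon> f N (h N) \<in> borel_measurable M" if "N \<ge> 1" for N
    by (rule measurable_estimate[OF assms(8) that h[OF that]]) measurable
  have Z_meas: "Z N \<in> borel_measurable M" and W_meas: "W N \<in> borel_measurable M" if "N \<ge> 1" for N
    using est_meas[OF that] unfolding Z_def[abs_def] W_eq[abs_def] by measurable
  \<comment> \<open>The absolute value matters for small sample sizes, where \<open>\<tau>\<close>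
    may be negative; integrability is claimed for those as well.\<close>
  have W_bound: "W N \<omega> \<le> \<bar>\<tau> (n N)\<bar> + 1" for N \<omega>
    using abs_truncate_at_le[of "\<tau> (n N)" "estimate T \<epsilon> f N (h N) \<omega>"] fx unfolding W_eq by linarith
  have W_int: "integrable M (\<lambda>\<omega>. W N \<omega> powr q)" if "N \<ge> 1" for N
  proof (rule integrable_const_bound)
    show "AE \<omega> in M. norm (W N \<omega> powr q) \<le> (\<bar>\<tau> (n N)\<bar> + 1) powr q"
      using W_bound assms(12) by (intro always_eventually allI) (auto simp: W_def intro!: powr_mono2)
    show "(\<lambda>\<omega>. W N \<omega> powr q) \<in> borel_measurable M" using W_meas[OF that] by measurable
  qed
  have n_lim: "filterlim n sequentially sequentially"
    using filterlim_local_size(1)[OF pos(1) assms(2,7)] by (simp add: n_def[abs_def] h_def)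
  define S where "S = (\<Sum>j. (2 + real j) powr q * exp (- (real j powr \<aa>)))"
  \<comment> \<open>Collects both terms of the concentration threshold in units of the rate:
    \<open>h N powr \<beta>\<close> equals \<open>r N\<close>, and
    \<open>real (n N) powr (- 1 / \<aa>)\<close> will be at most
    \<open>4 powr (1 / \<aa>) * r N\<close>.\<close>
  define K where "K = c1 + c2 * 4 powr (1 / \<aa>)"
  have "K > 0" using c by (simp add: K_def add_pos_pos)
  \<comment> \<open>The first summand comes from the shells, with 3 from the truncation; the second
    from the event beyond them.\<close>
  define C where "C = (3 * K) powr q * (1 + c3 * S) + c3 * 4 powr (q / \<aa>)"
  have "\<forall>\<^sub>F m in sequentially. \<bar>\<tau> m\<bar> \<le> real m powr \<nu>"
    using landau_o.smallD[OF assms(11), of 1] by simp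
  moreover have "\<forall>\<^sub>F m in sequentially. \<tau> m \<ge> 2"
    using assms(10) unfolding filterlim_at_top by blast
  ultimately have "\<forall>\<^sub>F m in sequentially. \<tau> m \<ge> 2 \<and> \<tau> m \<le> real m powr \<nu> \<and>
      (real m powr \<nu> + 1) powr q * exp (- ((real m powr \<nu>) powr \<aa>)) \<le> real m powr (- q / \<aa>)"
    using eventually_powr_times_exp_le_powr[OF pos(1) \<open>\<nu> > 0\<close>, of q] by eventually_elim auto
  \<comment> \<open>The truncation level is indexed by the local sample size, so its asymptotics are
    pulled back along \<open>n N\<close>, which tends to infinity.\<close>
  then have "\<forall>\<^sub>F N in sequentially. \<tau> (n N) \<ge> 2 \<and> \<tau> (n N) \<le> real (n N) powr \<nu> \<and>
      (real (n N) powr \<nu> + 1) powr q * exp (- ((real (n N) powr \<nu>) powr \<aa>)) \<le> real (n N) powr (- q / \<aa>)"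
    using n_lim by (rule eventually_compose_filterlim)
  moreover have "\<forall>\<^sub>F N in sequentially. real N powr (\<aa> * \<beta> / (\<aa> * \<beta> + 1)) / 4 \<le> real (n N)"
    using filterlim_local_size(2)[OF pos(1) assms(2,7)] by (simp add: n_def h_def)
  ultimately have "\<forall>\<^sub>F N in sequentially. expectation (\<lambda>\<omega>. W N \<omega> powr q) \<le> C * r N powr q"
    using eventually_ge_at_top[of 1]
  proof eventually_elim
    case (elim N)
    then have t2: "\<tau> (n N) \<ge> 2" and tn: "\<tau> (n N) \<le> real (n N) powr \<nu>"
      and ex: "(real (n N) powr \<nu> + 1) powr q * exp (- ((real (n N) powr \<nu>) powr \<aa>))
        \<le> real (n N) powr (- q / \<aa>)"
      and nN: "real N powr (\<aa> * \<beta> / (\<aa> * \<beta> + 1)) / 4 \<le> real (n N)" and N: "N \<ge> 1" by auto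
    have rate: "real (n N) powr (- 1 / \<aa>) \<le> 4 powr (1 / \<aa>) * r N"
    proof -
      have "real (n N) powr (- 1 / \<aa>) \<le> (real N powr (\<aa> * \<beta> / (\<aa> * \<beta> + 1)) / 4) powr (- 1 / \<aa>)"
        using nN N pos(1) by (intro powr_mono2') auto
      also have "\<dots> = (real N powr (\<aa> * \<beta> / (\<aa> * \<beta> + 1))) powr (- 1 / \<aa>) * 4 powr (1 / \<aa>)"
        by (simp add: powr_divide powr_minus_divide)
      also have "(real N powr (\<aa> * \<beta> / (\<aa> * \<beta> + 1))) powr (- 1 / \<aa>) = r N"
        using pos(1) by (simp add: powr_powr r_def)
      finally show ?thesis by (simp add: mult.commute)
    qed
    have tail: "prob {\<omega>\<in>space M. K * r N * (1 + v) \<le> Z N \<omega>} \<le> c3 * exp (- (v powr \<aa>))"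
      if v: "0 \<le> v" "v \<le> real (n N) powr \<nu>" for v
    proof -
      have "c1 * h N powr \<beta> + c2 * real (n N) powr (- 1 / \<aa>) * v
          \<le> c1 * r N + c2 * (4 powr (1 / \<aa>) * r N) * v"
        using rate c v unfolding h_def optimal_bandwidth_powr r_def
        by (intro add_mono mult_right_mono mult_left_mono) auto
      \<comment> \<open>The bias is also multiplied by 1 + v, which brings the threshold into the
        form s (1 + v) with \<open>s = K * r N\<close>. A larger threshold gives a smaller
        event.\<close>
      also have "\<dots> \<le> c1 * r N * (1 + v) + c2 * (4 powr (1 / \<aa>) * r N) * (1 + v)"
        using c v r_pos[OF N] by (intro add_mono mult_left_mono) (auto simp: algebra_simps)
      also have "\<dots> = K * r N * (1 + v)" by (simp add: K_def algebra_simps)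
      finally have "prob {\<omega>\<in>space M. K * r N * (1 + v) \<le> Z N \<omega>}
          \<le> prob {\<omega>\<in>space M. c1 * h N powr \<beta> + c2 * real (n N) powr (- 1 / \<aa>) * v \<le> Z N \<omega>}"
        using Z_meas[OF N] by (intro finite_measure_mono) auto
      also have "\<dots> \<le> c3 * exp (- (v powr \<aa>))"
        using conc[OF N h[OF N] v[unfolded n_def]] by (simp add: Z_def n_def)
      finally show ?thesis .
    qed
    have "expectation (\<lambda>\<omega>. W N \<omega> powr q) \<le> (3 * (K * r N)) powr q * (1 + c3 * S)
        + (\<tau> (n N) + 1) powr q * (c3 * exp (- ((real (n N) powr \<nu>) powr \<aa>)))"
      unfolding S_def
    \<comment> \<open>Here A = 3, \<open>s = K * r N\<close>,
      \<open>V = real (n N) powr \<nu>\<close> and \<open>B = \<tau> (n N) + 1\<close>.\<close>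
    proof (rule powr_expectation_le_of_tail[where Z = "Z N"])
      show "W N \<omega> \<le> 3 * Z N \<omega>" for \<omega>
        unfolding W_eq Z_def by (rule truncate_at_error_le[OF t2 fx])
      show "0 \<le> W N \<omega>" for \<omega> by (simp add: W_def)
      show "W N \<omega> \<le> \<tau> (n N) + 1" for \<omega> using W_bound[of N \<omega>] t2 by simp
    qed (use Z_meas[OF N] W_meas[OF N] \<open>K > 0\<close> r_pos[OF N] c pos(1) assms(12) tail in auto)
    \<comment> \<open>Since \<open>\<tau> (n N)\<close> is at most
      \<open>real (n N) powr \<nu>\<close>, the exponential reduces this term to the q-th power of
      the stochastic rate, which \<open>rate\<close> compares with \<open>r N\<close>.\<close>
    also have "(\<tau> (n N) + 1) powr q * (c3 * exp (- ((real (n N) powr \<nu>) powr \<aa>)))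
        \<le> c3 * 4 powr (q / \<aa>) * r N powr q"
    proof -
      have "(\<tau> (n N) + 1) powr q * exp (- ((real (n N) powr \<nu>) powr \<aa>))
          \<le> (real (n N) powr \<nu> + 1) powr q * exp (- ((real (n N) powr \<nu>) powr \<aa>))"
        using t2 tn assms(12) by (intro mult_right_mono powr_mono2) auto
      also have "\<dots> \<le> (real (n N) powr (- 1 / \<aa>)) powr q" using ex by (simp add: powr_powr)
      also have "\<dots> \<le> (4 powr (1 / \<aa>) * r N) powr q"
        using rate assms(12) by (intro powr_mono2) auto
      also have "\<dots> = 4 powr (q / \<aa>) * r N powr q"
        using r_pos[OF N] by (simp add: powr_mult powr_powr)
      finally show ?thesis using c by (simp add: mult.assoc mult.left_commute)
    qed
    finally show ?case
      using r_pos[OF N] \<open>K > 0\<close> by (simp add: C_def powr_mult algebra_simps)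
  qed
  then have "\<exists>C>0. \<forall>N\<ge>1. expectation (\<lambda>\<omega>. W N \<omega> powr q) \<le> C * r N powr q"
    by (rule uniform_bound_from_eventual) (use r_pos in force)
  then show ?thesis using W_int unfolding r_powr W_def by blast
qed

end
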